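(* Let $E$ be a uniformly convex (real) Banach space. Let $K$ be a bounded and convex subset of $E$ and let $T:K\to K$ be a mapping satisfying the (RSC)-condition. Let $\alpha\in[1/2,1)$ be a real number, let $x_1\in K$ be arbitrary but fixed, and define the sequence $\{x_n\}$ in $K$ by $$x_{n+1}=\alpha Tx_n+(1-\alpha)x_n \qquad (n\ge 1).$$ Assume that $\lim_{n\to\infty}\|Tx_n-x_n\|=0$. If $T$ satisfies condition (I), then $\{x_n\}$ converges strongly to a fixed point of $T$.
   Context: All Banach spaces are real. A mapping $T$ on a subset $K$ of a Banach space $E$ is a map $T:K\to K$; $F(T)=\{x\in K: Tx=x\}$ denotes its set of fixed points. (RSC)-condition (Reich--Suzuki-(C) condition): $T$ satisfies the (RSC)-condition if for all $x,y\in K$, the inequality $\frac12\|x-Tx\|\le\|x-y\|$ implies $$\|Tx-Ty\|\le\tfrac13\left(\|x-y\|+\|y-Ty\|+\|x-Tx\|\right).$$ Condition (I): a mapping $T:K\to K$ satisfies condition (I) if there exists a nondecreasing function $f:[0,\infty)\to[0,\infty)$ with $f(0)=0$ and $f(r)>0$ for all $r\in(0,\infty)$ such that $\|x-Tx\|\ge f(d(x,F(T)))$ for all $x\in K$, where $d(x,F(T))=\inf\{\|x-p\|:p\in F(T)\}$. *)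

theory Defs
  imports "HOL-Analysis.Analysis"
begin

definition uniformly_convex_space :: "'a::real_normed_vector itself \<Rightarrow> bool" where
  "uniformly_convex_space _ \<longleftrightarrow>
     (\<forall>\<epsilon>::real. 0 < \<epsilon> \<and> \<epsilon> \<le> 2 \<longrightarrow>
       (\<exists>\<delta>>0. \<forall>x y::'a. norm x \<le> 1 \<and> norm y \<le> 1 \<and> norm (x - y) \<ge> \<epsilon> \<longrightarrow>
          norm ((1/2) *\<^sub>R (x + y)) \<le> 1 - \<delta>))"

definition fixed_points :: "'a set \<Rightarrow> ('a \<Rightarrow> 'a) \<Rightarrow> 'a set" where
  "fixed_points K T = {x \<in> K. T x = x}"

definition RSC_condition :: "'a::real_normed_vector set \<Rightarrow> ('a \<Rightarrow> 'a) \<Rightarrow> bool" where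
  "RSC_condition K T \<longleftrightarrow>
     (\<forall>x\<in>K. \<forall>y\<in>K. (1/2) * norm (x - T x) \<le> norm (x - y) \<longrightarrow>
        norm (T x - T y) \<le> (1/3) * (norm (x - y) + norm (y - T y) + norm (x - T x)))"

(* Applying f :: [0,\<infinity>) \<Rightarrow> [0,\<infinity>) to d(x, F(T)) presupposes that this distance is a
   real number, i.e. that F(T) is nonempty. This has to be said explicitly because
   infdist x {} = 0, which would make the condition vacuous for mappings without fixed
   points. The values of f at negative arguments are irrelevant. *)
definition condition_I :: "'a::real_normed_vector set \<Rightarrow> ('a \<Rightarrow> 'a) \<Rightarrow> bool" where
  "condition_I K T \<longleftrightarrow> fixed_points K T \<noteq> {} \<and>
     (\<exists>f::real \<Rightarrow> real. mono_on {0..} f \<and> f 0 = 0 \<and> (\<forall>r>0. f r > 0) \<and>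
        (\<forall>x\<in>K. norm (x - T x) \<ge> f (infdist x (fixed_points K T))))"

end

theory Submission
  imports Defs
begin

text \<open>
  The (RSC)-condition contains only a third of each of its three distances. Comparing a point
  \<open>y\<close> with a fixed point \<open>p\<close>, whose own displacement vanishes, therefore costs at most
  \<open>\<parallel>p - y\<parallel> / 3\<close>, which the triangle inequality absorbs: the distance from \<open>y\<close> to \<open>p\<close> is
  controlled linearly by the displacement \<open>\<parallel>y - T y\<parallel>\<close> (lemma \<open>RSC_dist_fixed_point_le\<close>).
  Condition (I) supplies a fixed point, and since the displacements along the iteration tend to
  zero, the iterates converge to it.
\<close>

text \<open>
  At a fixed point the premise of the (RSC)-condition is \<open>0 \<le> \<parallel>p - y\<parallel>\<close>, so the pair \<open>p, y\<close> is
  always admissible and gives \<open>\<parallel>p - T y\<parallel> \<le> (\<parallel>p - y\<parallel> + \<parallel>y - T y\<parallel>) / 3\<close>. Inserting this into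
  \<open>\<parallel>y - p\<parallel> \<le> \<parallel>y - T y\<parallel> + \<parallel>T y - p\<parallel>\<close> leaves \<open>(2/3) \<parallel>y - p\<parallel> \<le> (4/3) \<parallel>y - T y\<parallel>\<close>.
\<close>

lemma RSC_dist_fixed_point_le:
  fixes K :: "'a::real_normed_vector set"
  assumes "RSC_condition K T" and "p \<in> fixed_points K T" and "y \<in> K"
  shows "norm (y - p) \<le> 2 * norm (T y - y)"
proof -
  have p: "p \<in> K" "T p = p"
    using assms(2) by (auto simp: fixed_points_def)
  have "(1/2) * norm (p - T p) \<le> norm (p - y)"
    using p by simp
  then have "norm (T p - T y) \<le> (1/3) * (norm (p - y) + norm (y - T y) + norm (p - T p))"
    using assms(1,3) p(1) unfolding RSC_condition_def by blast
  then have "norm (p - T y) \<le> (1/3) * (norm (p - y) + norm (y - T y))"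
    using p by simp
  moreover have "norm (p - y) \<le> norm (p - T y) + norm (T y - y)"
    using norm_triangle_ineq[of "p - T y" "T y - y"] by simp
  ultimately show ?thesis
    by (simp add: norm_minus_commute)
qed

lemma averaged_iteration_in_convex:
  fixes K :: "'a::real_vector set" and x :: "nat \<Rightarrow> 'a"
  assumes "convex K" and "T \<in> K \<rightarrow> K" and "0 \<le> \<alpha>" and "\<alpha> \<le> 1"
    and "x 1 \<in> K"
    and "\<And>n. n \<ge> 1 \<Longrightarrow> x (Suc n) = \<alpha> *\<^sub>R T (x n) + (1 - \<alpha>) *\<^sub>R x n"
    and "n \<ge> 1"
  shows "x n \<in> K"
  using assms(7)
proof (induction n rule: dec_induct)
  case base
  show ?case by (fact assms(5))
next
  case (step n)
  from step.IH have "T (x n) \<in> K"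
    using assms(2) by (simp add: Pi_iff)
  with step.IH have "\<alpha> *\<^sub>R T (x n) + (1 - \<alpha>) *\<^sub>R x n \<in> K"
    using assms(1,3,4) by (auto intro!: convexD)
  then show ?case
    using assms(6)[OF step.hyps(1)] by simp
qed

theorem theorem5:
  fixes K :: "'a::banach set" and T :: "'a \<Rightarrow> 'a" and \<alpha> :: real and x :: "nat \<Rightarrow> 'a"
  assumes "uniformly_convex_space TYPE('a)"
    and "bounded K" and "convex K"
    and "T \<in> K \<rightarrow> K"
    and "RSC_condition K T"
    and "1/2 \<le> \<alpha>" and "\<alpha> < 1"
    and "x 1 \<in> K"
    and "\<And>n. n \<ge> 1 \<Longrightarrow> x (Suc n) = \<alpha> *\<^sub>R T (x n) + (1 - \<alpha>) *\<^sub>R x n"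
    and "(\<lambda>n. norm (T (x n) - x n)) \<longlonglongrightarrow> 0"
    and "condition_I K T"
  shows "\<exists>p \<in> fixed_points K T. x \<longlonglongrightarrow> p"
proof -
  obtain p where p: "p \<in> fixed_points K T"
    using assms(11) unfolding condition_I_def by blast
  have bound: "norm (x n - p) \<le> 2 * norm (T (x n) - x n)" if "n \<ge> 1" for n
  proof -
    have "x n \<in> K"
      using assms(6,7) by (intro averaged_iteration_in_convex[OF assms(3,4) _ _ assms(8,9) that]) auto
    then show ?thesis
      by (rule RSC_dist_fixed_point_le[OF assms(5) p])
  qed
  have "(\<lambda>n. 2 * norm (T (x n) - x n)) \<longlonglongrightarrow> 0"
    using tendsto_mult_right_zero[OF assms(10)] .
  then have "(\<lambda>n. x n - p) \<longlonglongrightarrow> 0"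
    by (rule Lim_null_comparison[OF eventually_sequentiallyI[of 1], rotated]) (rule bound)
  then have "x \<longlonglongrightarrow> p"
    by (simp add: LIM_zero_iff)
  with p show ?thesis by blast
qed

end
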